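(* Let $N\geq 1$ and let $\gamma_1,\ldots,\gamma_N>0$ be distinct real numbers. Let $D\geq 1$ and fix $\mathbf{c}_1,\ldots,\mathbf{c}_N\in\mathbf{C}^D$. Let $F=(F_1,\ldots,F_D):\mathbf{R}^+\to\mathbf{R}^D$ be the function defined by $$F(x)=\sum_{n=1}^{N}\left(\mathbf{c}_n x^{i\gamma_n}+\overline{\mathbf{c}_n}x^{-i\gamma_n}\right)=\sum_{n=1}^{N}\left(\mathbf{a}_n\cos(\gamma_n\log x)+\mathbf{b}_n\sin(\gamma_n\log x)\right),$$ where $\mathbf{a}_n,\mathbf{b}_n\in\mathbf{R}^D$ (that is, $\mathbf{a}_n=2\,\mathrm{Re}\,\mathbf{c}_n$ and $\mathbf{b}_n=-2\,\mathrm{Im}\,\mathbf{c}_n$). The image of $F$ is contained in a compact subset of the subspace $V_F$ of $\mathbf{R}^D$ generated by the vectors $\mathbf{a}_1,\ldots,\mathbf{a}_N,\mathbf{b}_1,\ldots,\mathbf{b}_N$. Then, for every linear subspace $H\subset\mathbf{R}^D$ not containing $V_F$ and every vector $\alpha\in\mathbf{R}^D$, one has $\delta(F\in\alpha+H)=0$. In particular, if $V_F\not\subset\bigcup_{d=1}^{D}\{x\in\mathbf{R}^D : x_d=0\}$, then for every $\alpha_1,\ldots,\alpha_D\in\mathbf{R}$ one has $\delta(F_d=\alpha_d)=0$ for all $1\leq d\leq D$, and the logarithmic density $$\delta(F_1>\alpha_1,F_2>\alpha_2,\ldots,F_D>\alpha_D)$$ exists.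
   Context: For a set $\mathcal{P}$ of positive real numbers, its logarithmic density is $$\delta(\mathcal{P})=\lim_{X\to\infty}\frac{1}{\log X}\int_1^X\mathbf{1}_{\mathcal{P}}(x)\frac{dx}{x}$$ if the limit exists, where $\mathbf{1}_{\mathcal{P}}$ is the indicator function of $\mathcal{P}$. For a condition on $F$, $\delta(\text{condition})$ denotes the logarithmic density of the set of $x>0$ for which $F(x)$ satisfies the condition; e.g. $\delta(F\in\alpha+H)=\delta(\{x: F(x)\in\alpha+H\})$. The assertion $\delta(\cdot)=0$ includes the existence of the limit. *)

theory Defs
  imports "HOL-Analysis.Analysis"
begin

text \<open>Integrability is required explicitly, since the integral of a non-integrable function
  is 0 by convention.\<close>
definition has_log_density :: "real set \<Rightarrow> real \<Rightarrow> bool" where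
  "has_log_density P l \<longleftrightarrow>
     (\<forall>X\<ge>1. set_integrable lebesgue {1..X} (\<lambda>x. indicat_real P x / x)) \<and>
     ((\<lambda>X. 1 / ln X * (LINT x:{1..X}|lebesgue. indicat_real P x / x)) \<longlongrightarrow> l) at_top"

definition vec_cnj :: "complex ^ 'd \<Rightarrow> complex ^ 'd" where
  "vec_cnj v = (\<chi> d. cnj (v $ d))"

definition osc_complex ::
  "nat \<Rightarrow> (nat \<Rightarrow> real) \<Rightarrow> (nat \<Rightarrow> complex ^ 'd) \<Rightarrow> real \<Rightarrow> complex ^ 'd" where
  "osc_complex N \<gamma> c x =
     (\<Sum>n=1..N. (of_real x powr (\<i> * of_real (\<gamma> n))) *s c n
              + (of_real x powr (- \<i> * of_real (\<gamma> n))) *s vec_cnj (c n))"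

text \<open>For positive \<open>x\<close> all components of the complex sum are real, so taking real parts
  only changes the type.\<close>
definition osc :: "nat \<Rightarrow> (nat \<Rightarrow> real) \<Rightarrow> (nat \<Rightarrow> complex ^ 'd) \<Rightarrow> real \<Rightarrow> real ^ 'd" where
  "osc N \<gamma> c x = (\<chi> d. Re (osc_complex N \<gamma> c x $ d))"

definition cos_vec :: "(nat \<Rightarrow> complex ^ 'd) \<Rightarrow> nat \<Rightarrow> real ^ 'd" where
  "cos_vec c n = (\<chi> d. 2 * Re (c n $ d))"

definition sin_vec :: "(nat \<Rightarrow> complex ^ 'd) \<Rightarrow> nat \<Rightarrow> real ^ 'd" where
  "sin_vec c n = (\<chi> d. - 2 * Im (c n $ d))"

definition osc_space :: "nat \<Rightarrow> (nat \<Rightarrow> complex ^ 'd) \<Rightarrow> (real ^ 'd) set" where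
  "osc_space N c = span (cos_vec c ` {1..N} \<union> sin_vec c ` {1..N})"

end

theory Submission
  imports Defs "HOL-Complex_Analysis.Complex_Analysis"
begin

text \<open>In the variable \<open>t = ln x\<close> the logarithmic density becomes the ordinary density on the half
line, and every scalar product \<open>v \<bullet> F\<close> becomes a real trigonometric polynomial with the
distinct positive frequencies \<open>\<gamma> n\<close>. Everything rests on two properties of such functions.

\<^item> If the coefficient at some \<open>\<gamma> k\<close> is nonzero, the polynomial is not constant, since its product
  with its own wave of frequency \<open>\<gamma> k\<close> has a positive mean whereas a constant times that wave has
  mean 0. It extends to an entire function, so its level sets are countable
  (\<open>countable_level_set\<close>). If \<open>H\<close> does not contain the space spanned by the coefficient
  vectors, some \<open>v\<close> orthogonal to \<open>H\<close> is not orthogonal to that space; the set where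
  \<open>F \<in> \<alpha> + H\<close> lies in a level set of \<open>v \<bullet> F\<close>, so it is countable and has density 0.

\<^item> Polynomials in trigonometric polynomials are again trigonometric polynomials, and these have
  mean values. By the Weierstrass approximation theorem \<open>\<phi> \<circ> F\<close> has a mean value for every
  continuous \<open>\<phi>\<close> (\<open>continuous_image_has_mean\<close>).

To pass from continuous \<open>\<phi>\<close> to the indicator of an orthant one squeezes the indicator between two
continuous functions that differ only where some \<open>F_d\<close> is within \<open>\<epsilon>\<close> of \<open>\<alpha>_d\<close>. That these times
have small density is more than the countability of the level sets: it is a uniform statement.
It follows by compactness (\<open>uniformly_thin_level_sets\<close>). A translate of a trigonometric polynomial
is obtained by rotating its coefficients, so all translates, restricted to a unit interval,
belong to a compact family of functions each of which has countable level sets.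
Hence the near-level sets have uniformly small measure on all unit intervals.\<close>

section \<open>Mean values on the half line\<close>

definition has_mean :: "(real \<Rightarrow> real) \<Rightarrow> real \<Rightarrow> bool" where
  "has_mean f m \<longleftrightarrow>
     continuous_on UNIV f \<and> ((\<lambda>T. integral {0..T} f / T) \<longlongrightarrow> m) at_top"

lemma has_mean_integrable: "has_mean f m \<Longrightarrow> f integrable_on {a..b}"
  unfolding has_mean_def
  by (meson continuous_on_subset integrable_continuous_interval subset_UNIV)

lemma has_mean_unique: "has_mean f m \<Longrightarrow> has_mean f m' \<Longrightarrow> m = m'"
  unfolding has_mean_def using tendsto_unique trivial_limit_at_top_linorder by blast

lemma has_mean_add:
  assumes "has_mean f m" "has_mean g m'"
  shows "has_mean (\<lambda>t. f t + g t) (m + m')"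
  unfolding has_mean_def
proof
  show "continuous_on UNIV (\<lambda>t. f t + g t)"
    using assms unfolding has_mean_def by (auto intro: continuous_intros)
  have "((\<lambda>T. integral {0..T} f / T + integral {0..T} g / T) \<longlongrightarrow> m + m') at_top"
    using assms unfolding has_mean_def by (auto intro: tendsto_add)
  then show "((\<lambda>T. integral {0..T} (\<lambda>t. f t + g t) / T) \<longlongrightarrow> m + m') at_top"
    using assms by (simp add: integral_add has_mean_integrable add_divide_distrib)
qed

lemma has_mean_cmult:
  assumes "has_mean f m"
  shows "has_mean (\<lambda>t. k * f t) (k * m)"
  unfolding has_mean_def
proof
  show "continuous_on UNIV (\<lambda>t. k * f t)"
    using assms unfolding has_mean_def by (auto intro: continuous_intros)
  have "((\<lambda>T. k * (integral {0..T} f / T)) \<longlongrightarrow> k * m) at_top"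
    using assms unfolding has_mean_def by (intro tendsto_mult_left) simp
  then show "((\<lambda>T. integral {0..T} (\<lambda>t. k * f t) / T) \<longlongrightarrow> k * m) at_top"
    by simp
qed

lemma has_mean_const: "has_mean (\<lambda>t. k) k"
proof -
  have "((\<lambda>T. integral {0..T} (\<lambda>t. k) / T) \<longlongrightarrow> k) at_top"
    by (rule tendsto_eventually)
       (use eventually_gt_at_top[of 0] in eventually_elim, auto)
  then show ?thesis by (simp add: has_mean_def)
qed

lemma has_mean_sum:
  assumes "\<And>i. i \<in> I \<Longrightarrow> has_mean (f i) (m i)"
  shows "has_mean (\<lambda>t. \<Sum>i\<in>I. f i t) (\<Sum>i\<in>I. m i)"
  using assms
proof (induction I rule: infinite_finite_induct)
  case (insert i I)
  then show ?case using has_mean_add[of "f i" "m i"] by simp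
qed (use has_mean_const[of 0] in auto)

lemma average_mono:
  fixes f g :: "real \<Rightarrow> real"
  assumes "continuous_on UNIV f" "continuous_on UNIV g" "\<And>t. f t \<le> g t" "T > 0"
  shows "integral {0..T} f / T \<le> integral {0..T} g / T"
  using assms
  by (intro divide_right_mono integral_le integrable_continuous_interval)
     (auto intro: continuous_on_subset)

lemma has_mean_mono:
  assumes "has_mean f m" "has_mean g m'" "\<And>t. f t \<le> g t"
  shows "m \<le> m'"
proof (rule tendsto_le)
  show "((\<lambda>T. integral {0..T} f / T) \<longlongrightarrow> m) at_top" "((\<lambda>T. integral {0..T} g / T) \<longlongrightarrow> m') at_top"
    using assms has_mean_def by blast+
  show "\<forall>\<^sub>F T in at_top. integral {0..T} f / T \<le> integral {0..T} g / T"
    using eventually_gt_at_top[of 0]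
    by eventually_elim (use assms has_mean_def average_mono in blast)
qed simp

text \<open>The mean is the limit of the averages over \<open>{0..n}\<close>, which are averages of \<open>n\<close> integrals
over unit intervals. So an estimate that is uniform under translation is inherited by the mean.\<close>

lemma has_mean_le_of_unit_intervals:
  assumes m: "has_mean f m" and le: "\<And>s. integral {s..s+1} f \<le> \<eta>"
  shows "m \<le> \<eta>"
proof -
  have *: "integral {0..real n} f \<le> real n * \<eta>" for n
  proof (induction n)
    case (Suc n)
    have "integral {0..real n} f + integral {real n..real n + 1} f = integral {0..real n + 1} f"
      by (intro Henstock_Kurzweil_Integration.integral_combine has_mean_integrable[OF m]) auto
    then show ?case using Suc le[of "real n"] by (simp add: algebra_simps)
  qed simp
  have "((\<lambda>T. integral {0..T} f / T) \<longlongrightarrow> m) at_top" using m has_mean_def by blast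
  then have "(\<lambda>n. integral {0..real n} f / real n) \<longlonglongrightarrow> m"
    by (rule filterlim_compose[OF _ filterlim_real_sequentially])
  moreover have "\<forall>n\<ge>1. integral {0..real n} f / real n \<le> \<eta>"
    using * by (auto simp: divide_le_eq mult.commute)
  ultimately show ?thesis by (blast intro: LIMSEQ_le_const2)
qed

text \<open>Functions with limits stand in for the lower and upper limits of \<open>A\<close>: every lower limit \<open>L\<close>
is at most every upper limit \<open>U\<close>, and since they come arbitrarily close, the supremum of the
possible \<open>L\<close> is the limit. The criterion serves both for uniform approximation of a continuous function and
for the approximation of an indicator function.\<close>

lemma tendsto_by_sandwich:
  fixes A :: "real \<Rightarrow> real"
  assumes approx: "\<And>\<eta>. \<eta> > 0 \<Longrightarrow> \<exists>l u L U. (l \<longlongrightarrow> L) at_top \<and> (u \<longlongrightarrow> U) at_top \<and> U - L \<le> \<eta> \<and>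
      (\<forall>\<^sub>F T in at_top. l T \<le> A T \<and> A T \<le> u T)"
  shows "\<exists>a. (A \<longlongrightarrow> a) at_top"
proof -
  define lower where "lower L \<longleftrightarrow> (\<forall>\<epsilon>>0. \<forall>\<^sub>F T in at_top. L - \<epsilon> < A T)" for L
  define upper where "upper U \<longleftrightarrow> (\<forall>\<epsilon>>0. \<forall>\<^sub>F T in at_top. A T < U + \<epsilon>)" for U
  have ex: "\<exists>L U. lower L \<and> upper U \<and> U - L \<le> \<eta>" if "\<eta> > 0" for \<eta>
  proof -
    obtain l u L U where *: "(l \<longlongrightarrow> L) at_top" "(u \<longlongrightarrow> U) at_top" "U - L \<le> \<eta>"
      "\<forall>\<^sub>F T in at_top. l T \<le> A T \<and> A T \<le> u T"
      using approx[OF \<open>\<eta> > 0\<close>] by blast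
    have "lower L" unfolding lower_def
    proof safe
      fix \<epsilon> :: real assume "\<epsilon> > 0"
      then have "\<forall>\<^sub>F T in at_top. L - \<epsilon> < l T" using order_tendstoD(1)[OF *(1)] by simp
      with *(4) show "\<forall>\<^sub>F T in at_top. L - \<epsilon> < A T" by eventually_elim auto
    qed
    moreover have "upper U" unfolding upper_def
    proof safe
      fix \<epsilon> :: real assume "\<epsilon> > 0"
      then have "\<forall>\<^sub>F T in at_top. u T < U + \<epsilon>" using order_tendstoD(2)[OF *(2)] by simp
      with *(4) show "\<forall>\<^sub>F T in at_top. A T < U + \<epsilon>" by eventually_elim auto
    qed
    ultimately show ?thesis using *(3) by blast
  qed
  have le: "L \<le> U" if "lower L" "upper U" for L U
  proof (rule field_le_epsilon)
    fix \<epsilon> :: real assume "\<epsilon> > 0"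
    then have "\<epsilon> / 2 > 0" by simp
    then have "\<forall>\<^sub>F T in at_top. L - \<epsilon>/2 < A T" "\<forall>\<^sub>F T in at_top. A T < U + \<epsilon>/2"
      using that unfolding lower_def upper_def by blast+
    then have "\<forall>\<^sub>F T in at_top::real filter. L \<le> U + \<epsilon>" by eventually_elim auto
    then show "L \<le> U + \<epsilon>" by simp
  qed
  define a where "a = Sup {L. lower L}"
  have bdd: "bdd_above {L. lower L}" and ne: "{L. lower L} \<noteq> {}"
    using ex[of 1] le by (auto simp: bdd_above_def)
  have la: "L \<le> a" if "lower L" for L
    unfolding a_def using that bdd by (simp add: cSup_upper)
  have au: "a \<le> U" if "upper U" for U
    unfolding a_def using ne le that by (intro cSup_least) auto
  have "(A \<longlongrightarrow> a) at_top"
  proof (rule tendstoI)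
    fix e :: real assume "e > 0"
    then obtain L U where LU: "lower L" "upper U" "U - L \<le> e / 2" using ex[of "e/2"] by auto
    have "\<forall>\<^sub>F T in at_top. L - e/4 < A T" "\<forall>\<^sub>F T in at_top. A T < U + e/4"
      using LU \<open>e > 0\<close> unfolding lower_def upper_def by auto
    then show "\<forall>\<^sub>F T in at_top. dist (A T) a < e"
    proof eventually_elim
      case (elim T)
      then show ?case
        using la[OF LU(1)] au[OF LU(2)] LU(3) \<open>e > 0\<close>
        unfolding dist_real_def abs_less_iff by argo
    qed
  qed
  then show ?thesis ..
qed

section \<open>Trigonometric polynomials and their continuous images\<close>

definition wave :: "complex \<Rightarrow> real \<Rightarrow> real \<Rightarrow> real" where
  "wave z \<omega> t = Re (z * cis (\<omega> * t))"

lemma wave_altdef: "wave z \<omega> t = Re z * cos (\<omega> * t) - Im z * sin (\<omega> * t)"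
  by (simp add: wave_def)

lemma continuous_on_wave [continuous_intros]: "continuous_on S (wave z \<omega>)"
  unfolding wave_altdef by (intro continuous_intros)

lemma wave_mult:
  "wave z a t * wave w b t = wave (z * w / 2) (a + b) t + wave (z * cnj w / 2) (a - b) t"
proof -
  have eq: "(a + b) * t = a * t + b * t" "(a - b) * t = a * t - b * t"
    by (simp_all add: algebra_simps)
  show ?thesis
    unfolding wave_altdef eq cos_add sin_add cos_diff sin_diff by (simp add: field_simps)
qed

lemma has_mean_wave: "has_mean (wave z \<omega>) (if \<omega> = 0 then Re z else 0)"
proof (cases "\<omega> = 0")
  case True
  then show ?thesis
    using has_mean_const[of "Re z"] by (simp add: wave_altdef[abs_def])
next
  case False
  define G where "G T = Im (z * cis (\<omega> * T)) / \<omega>" for T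
  have int: "integral {0..T} (wave z \<omega>) = G T - G 0" if "T \<ge> 0" for T
  proof (rule integral_unique, rule fundamental_theorem_of_calculus[OF that])
    fix t assume "t \<in> {0..T}"
    show "(G has_vector_derivative wave z \<omega> t) (at t within {0..T})"
      unfolding G_def wave_altdef using False
      by (auto intro!: derivative_eq_intros simp: has_real_derivative_iff_has_vector_derivative[symmetric]
          field_simps)
  qed
  have bound: "\<bar>G T\<bar> \<le> cmod z / \<bar>\<omega>\<bar>" for T
  proof -
    have "\<bar>Im (z * cis (\<omega> * T))\<bar> \<le> cmod (z * cis (\<omega> * T))" by (rule abs_Im_le_cmod)
    then show ?thesis by (simp add: G_def norm_mult divide_right_mono)
  qed
  have "((\<lambda>T. (G T - G 0) / T) \<longlongrightarrow> 0) at_top"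
  proof (rule Lim_null_comparison)
    show "\<forall>\<^sub>F T in at_top. norm ((G T - G 0) / T) \<le> (2 * cmod z / \<bar>\<omega>\<bar>) / T"
      using eventually_gt_at_top[of 0]
    proof eventually_elim
      case (elim T)
      have "\<bar>G T - G 0\<bar> \<le> 2 * cmod z / \<bar>\<omega>\<bar>" using bound[of T] bound[of 0] by auto
      then have "\<bar>G T - G 0\<bar> / T \<le> (2 * cmod z / \<bar>\<omega>\<bar>) / T"
        using elim by (intro divide_right_mono) auto
      then show ?case using elim by simp
    qed
    show "((\<lambda>T. (2 * cmod z / \<bar>\<omega>\<bar>) / T) \<longlongrightarrow> 0) at_top"
      by (intro tendsto_divide_0[OF tendsto_const] filterlim_at_top_imp_at_infinity filterlim_ident)
  qed
  moreover have "\<forall>\<^sub>F T in at_top. (G T - G 0) / T = integral {0..T} (wave z \<omega>) / T"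
    using eventually_ge_at_top[of 0] by eventually_elim (simp add: int)
  ultimately have "((\<lambda>T. integral {0..T} (wave z \<omega>) / T) \<longlongrightarrow> 0) at_top"
    using tendsto_cong by fast
  then show ?thesis using False by (simp add: has_mean_def continuous_on_wave)
qed

text \<open>Arbitrary real frequencies are admitted, among them 0, which yields the constants; this makes
the class closed under products.\<close>

inductive trig_poly :: "(real \<Rightarrow> real) \<Rightarrow> bool" where
  wave: "trig_poly (wave z \<omega>)"
| add: "trig_poly f \<Longrightarrow> trig_poly g \<Longrightarrow> trig_poly (\<lambda>t. f t + g t)"

lemma trig_poly_const: "trig_poly (\<lambda>t. k)"
  using trig_poly.wave[of "of_real k" 0] by (simp add: wave_altdef[abs_def])

lemma trig_poly_sum:
  "(\<And>i. i \<in> I \<Longrightarrow> trig_poly (f i)) \<Longrightarrow> trig_poly (\<lambda>t. \<Sum>i\<in>I. f i t)"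
  by (induction I rule: infinite_finite_induct) (auto intro: trig_poly_const trig_poly.add)

lemma trig_poly_mult_wave:
  assumes "trig_poly f"
  shows "trig_poly (\<lambda>t. f t * wave w b t)"
  using assms
proof induction
  case (wave z \<omega>)
  show ?case unfolding wave_mult by (intro trig_poly.intros)
next
  case (add f g)
  then show ?case by (simp add: distrib_right trig_poly.add)
qed

lemma trig_poly_mult:
  assumes "trig_poly f" "trig_poly g"
  shows "trig_poly (\<lambda>t. f t * g t)"
  using assms(2)
proof induction
  case (wave z \<omega>)
  show ?case by (rule trig_poly_mult_wave[OF assms(1)])
next
  case (add g h)
  then show ?case by (simp add: distrib_left trig_poly.add)
qed

lemma trig_poly_continuous_on: "trig_poly f \<Longrightarrow> continuous_on S f"
  by (induction rule: trig_poly.induct) (auto intro!: continuous_intros)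

lemma trig_poly_bounded: "trig_poly f \<Longrightarrow> \<exists>B. \<forall>t. \<bar>f t\<bar> \<le> B"
proof (induction rule: trig_poly.induct)
  case (wave z \<omega>)
  have "\<bar>wave z \<omega> t\<bar> \<le> cmod z" for t
    unfolding wave_def using abs_Re_le_cmod[of "z * cis (\<omega> * t)"] by (simp add: norm_mult)
  then show ?case by blast
next
  case (add f g)
  then obtain B C where "\<forall>t. \<bar>f t\<bar> \<le> B" "\<forall>t. \<bar>g t\<bar> \<le> C" by blast
  then have "\<bar>f t + g t\<bar> \<le> B + C" for t
    using abs_triangle_ineq[of "f t" "g t"] by (meson add_mono order_trans)
  then show ?case by blast
qed

lemma trig_poly_has_mean: "trig_poly f \<Longrightarrow> \<exists>m. has_mean f m"
proof (induction rule: trig_poly.induct)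
  case (wave z \<omega>)
  then show ?case using has_mean_wave by blast
next
  case (add f g)
  then show ?case using has_mean_add by blast
qed

lemma trig_poly_polynomial:
  fixes h :: "real \<Rightarrow> real ^ 'd"
  assumes p: "real_polynomial_function p" and h: "\<And>d. trig_poly (\<lambda>t. h t $ d)"
  shows "trig_poly (\<lambda>t. p (h t))"
  using p
proof induction
  case (linear f)
  have "f (h t) = (\<Sum>d\<in>UNIV. h t $ d * f (axis d 1))" for t
  proof -
    have "f (h t) = f (\<Sum>d\<in>UNIV. (h t $ d) *\<^sub>R axis d 1)"
      by (simp add: basis_expansion[of "h t", unfolded scalar_mult_eq_scaleR])
    also have "\<dots> = (\<Sum>d\<in>UNIV. h t $ d * f (axis d 1))"
      using linear by (simp add: bounded_linear.linear linear_sum linear_cmul)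
    finally show ?thesis .
  qed
  then show ?case by (simp add: trig_poly_sum trig_poly_mult h trig_poly_const)
qed (auto intro: trig_poly_const trig_poly.add trig_poly_mult)

text \<open>The function \<open>h\<close> takes values in a ball, on which \<open>\<phi>\<close> is a uniform limit of polynomials \<open>p\<close>,
and \<open>p \<circ> h\<close> is a trigonometric polynomial. A uniform error of \<open>\<eta> / 2\<close> moves every average by at
most \<open>\<eta> / 2\<close>, so the averages of \<open>\<phi> \<circ> h\<close> are squeezed.\<close>

lemma continuous_image_has_mean:
  fixes h :: "real \<Rightarrow> real ^ 'd"
  assumes h: "\<And>d. trig_poly (\<lambda>t. h t $ d)" and \<phi>: "continuous_on UNIV \<phi>"
  shows "\<exists>m. has_mean (\<lambda>t. \<phi> (h t)) m"
proof -
  have "\<exists>B. \<forall>t. \<bar>h t $ d\<bar> \<le> B" for d using trig_poly_bounded[OF h] .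
  then obtain B where B: "\<And>t d. \<bar>h t $ d\<bar> \<le> B d" by metis
  define K where "K = cball (0::real^'d) (\<Sum>d\<in>UNIV. B d)"
  have hK: "h t \<in> K" for t
  proof -
    have "norm (h t) \<le> (\<Sum>d\<in>UNIV. \<bar>h t $ d\<bar>)" by (rule norm_le_l1_cart)
    also have "\<dots> \<le> (\<Sum>d\<in>UNIV. B d)" by (intro sum_mono B)
    finally show ?thesis by (simp add: K_def)
  qed
  have conth: "continuous_on UNIV h"
    using trig_poly_continuous_on[OF h] by (subst continuous_on_componentwise) (auto simp: Basis_vec_def inner_axis)
  have cont: "continuous_on UNIV (\<lambda>t. \<phi> (h t))"
    using continuous_on_compose2[OF \<phi> conth] by simp
  have "\<exists>m. ((\<lambda>T. integral {0..T} (\<lambda>t. \<phi> (h t)) / T) \<longlongrightarrow> m) at_top"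
  proof (rule tendsto_by_sandwich)
    fix \<eta> :: real assume "\<eta> > 0"
    obtain p where p: "real_polynomial_function p" "\<And>y. y \<in> K \<Longrightarrow> \<bar>\<phi> y - p y\<bar> < \<eta> / 2"
      using Stone_Weierstrass_real_polynomial_function[of K \<phi> "\<eta> / 2"] \<phi> \<open>\<eta> > 0\<close>
      by (auto simp: K_def intro: continuous_on_subset)
    obtain m where m: "has_mean (\<lambda>t. p (h t)) m"
      using trig_poly_has_mean[OF trig_poly_polynomial[OF p(1) h]] by blast
    have lo: "has_mean (\<lambda>t. p (h t) + (- \<eta> / 2)) (m + (- \<eta> / 2))"
      and up: "has_mean (\<lambda>t. p (h t) + \<eta> / 2) (m + \<eta> / 2)"
      by (intro has_mean_add m has_mean_const)+
    have bd: "p (h t) + (- \<eta> / 2) \<le> \<phi> (h t)" "\<phi> (h t) \<le> p (h t) + \<eta> / 2" for t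
      using p(2)[OF hK[of t]] unfolding abs_less_iff by linarith+
    have contlu: "continuous_on UNIV (\<lambda>t. p (h t) + (- \<eta> / 2))"
      "continuous_on UNIV (\<lambda>t. p (h t) + \<eta> / 2)"
      using lo up has_mean_def by blast+
    show "\<exists>l u L U. (l \<longlongrightarrow> L) at_top \<and> (u \<longlongrightarrow> U) at_top \<and> U - L \<le> \<eta> \<and>
      (\<forall>\<^sub>F T in at_top. l T \<le> integral {0..T} (\<lambda>t. \<phi> (h t)) / T \<and>
          integral {0..T} (\<lambda>t. \<phi> (h t)) / T \<le> u T)"
    proof (intro exI conjI)
      show "((\<lambda>T. integral {0..T} (\<lambda>t. p (h t) + (- \<eta> / 2)) / T) \<longlongrightarrow> m + (- \<eta> / 2)) at_top"
        using lo has_mean_def by blast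
      show "((\<lambda>T. integral {0..T} (\<lambda>t. p (h t) + \<eta> / 2) / T) \<longlongrightarrow> m + \<eta> / 2) at_top"
        using up has_mean_def by blast
      show "\<forall>\<^sub>F T in at_top.
          integral {0..T} (\<lambda>t. p (h t) + (- \<eta> / 2)) / T \<le> integral {0..T} (\<lambda>t. \<phi> (h t)) / T \<and>
          integral {0..T} (\<lambda>t. \<phi> (h t)) / T \<le> integral {0..T} (\<lambda>t. p (h t) + \<eta> / 2) / T"
        using eventually_gt_at_top[of 0]
        by eventually_elim (intro conjI average_mono contlu cont bd)
    qed simp
  qed
  then show ?thesis using cont by (auto simp: has_mean_def)
qed

section \<open>Level sets of trigonometric sums\<close>

definition trig_sum :: "nat set \<Rightarrow> (nat \<Rightarrow> real) \<Rightarrow> (nat \<Rightarrow> complex) \<Rightarrow> real \<Rightarrow> real" where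
  "trig_sum I \<gamma> z t = (\<Sum>n\<in>I. wave (z n) (\<gamma> n) t)"

lemma trig_poly_trig_sum: "trig_poly (trig_sum I \<gamma> z)"
  unfolding trig_sum_def by (intro trig_poly_sum trig_poly.wave)

text \<open>Translation only rotates the coefficients and preserves their absolute values. The
orbit of a trigonometric sum under translation therefore stays in a compact family.\<close>

lemma trig_sum_shift: "trig_sum I \<gamma> z (s + t) = trig_sum I \<gamma> (\<lambda>n. z n * cis (\<gamma> n * s)) t"
  by (simp add: trig_sum_def wave_def cis_mult[symmetric] distrib_left mult.assoc)

text \<open>Waves of distinct positive frequencies are orthogonal to each other and to the constants with
respect to the mean, and the wave \<open>z k\<close> has mean square \<open>|z k|\<^sup>2 / 2\<close>.\<close>

lemma trig_sum_nonconstant: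
  assumes "finite I" "\<forall>n\<in>I. \<gamma> n > 0" "inj_on \<gamma> I" "k \<in> I" "z k \<noteq> 0"
  shows "\<exists>t. trig_sum I \<gamma> z t \<noteq> a"
proof (rule ccontr)
  assume "\<not> ?thesis"
  then have const: "trig_sum I \<gamma> z t = a" for t by blast
  define m where "m n = (if n = k then (cmod (z k))\<^sup>2 / 2 else 0)" for n
  have "has_mean (\<lambda>t. wave (z n) (\<gamma> n) t * wave (z k) (\<gamma> k) t) (m n)" if "n \<in> I" for n
  proof -
    \<comment> \<open>Positivity excludes the sum frequency 0; distinctness isolates the difference frequency 0.\<close>
    have "\<gamma> n + \<gamma> k \<noteq> 0" "\<gamma> n - \<gamma> k = 0 \<longleftrightarrow> n = k"
      using assms that by (auto simp: inj_on_eq_iff) (metis add_pos_pos less_irrefl)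
    then have "m n = (if \<gamma> n + \<gamma> k = 0 then Re (z n * z k / 2) else 0)
        + (if \<gamma> n - \<gamma> k = 0 then Re (z n * cnj (z k) / 2) else 0)"
      by (simp add: m_def complex_mult_cnj cmod_power2)
    then show ?thesis
      unfolding wave_mult using has_mean_add[OF has_mean_wave has_mean_wave] by metis
  qed
  then have "has_mean (\<lambda>t. \<Sum>n\<in>I. wave (z n) (\<gamma> n) t * wave (z k) (\<gamma> k) t) (\<Sum>n\<in>I. m n)"
    by (rule has_mean_sum)
  moreover have "(\<Sum>n\<in>I. m n) = (cmod (z k))\<^sup>2 / 2"
    using assms by (simp add: m_def)
  moreover have "(\<Sum>n\<in>I. wave (z n) (\<gamma> n) t * wave (z k) (\<gamma> k) t) = a * wave (z k) (\<gamma> k) t" for t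
    using const[of t] by (simp add: trig_sum_def sum_distrib_right[symmetric])
  ultimately have "has_mean (\<lambda>t. a * wave (z k) (\<gamma> k) t) ((cmod (z k))\<^sup>2 / 2)" by simp
  moreover have "has_mean (\<lambda>t. a * wave (z k) (\<gamma> k) t) (a * 0)"
    using has_mean_cmult[OF has_mean_wave[of "z k" "\<gamma> k"], of a] assms by auto
  ultimately have "(cmod (z k))\<^sup>2 / 2 = a * 0" by (rule has_mean_unique)
  then show False using assms by simp
qed

text \<open>Replacing \<open>t\<close> by a complex variable turns the sum into a nonconstant entire function, whose
zeros are isolated.\<close>

lemma countable_level_set:
  assumes "finite I" "\<forall>n\<in>I. \<gamma> n > 0" "inj_on \<gamma> I" "k \<in> I" "z k \<noteq> 0"
  shows "countable {t. trig_sum I \<gamma> z t = a}"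
proof -
  define H where "H w = (\<Sum>n\<in>I. of_real (Re (z n)) * cos (of_real (\<gamma> n) * w)
      - of_real (Im (z n)) * sin (of_real (\<gamma> n) * w)) - complex_of_real a" for w
  have H_real: "H (of_real t) = of_real (trig_sum I \<gamma> z t - a)" for t
    by (simp add: H_def trig_sum_def wave_altdef cos_of_real sin_of_real flip: of_real_mult)
  have "H holomorphic_on UNIV"
    unfolding H_def by (intro holomorphic_intros)
  moreover have "\<not> H constant_on UNIV"
  proof
    assume "H constant_on UNIV"
    then have "H (of_real t) = H (of_real 0)" for t by (auto simp: constant_on_def)
    then have "trig_sum I \<gamma> z t = trig_sum I \<gamma> z 0" for t
      unfolding H_real of_real_eq_iff by simp
    then show False using trig_sum_nonconstant[of I \<gamma> k z] assms by metis
  qed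
  ultimately have "countable {w \<in> UNIV. H w = 0}"
    by (intro holomorphic_countable_zeros) auto
  moreover have "of_real ` {t. trig_sum I \<gamma> z t = a} \<subseteq> {w \<in> UNIV. H w = 0}"
    by (auto simp: H_real)
  ultimately have "countable (complex_of_real ` {t. trig_sum I \<gamma> z t = a})"
    using countable_subset by blast
  then show ?thesis by (simp add: countable_image_inj_eq inj_on_def)
qed

text \<open>A continuous cut-off: \<open>tent ((y - a) / \<epsilon>)\<close> vanishes unless \<open>y\<close> is within \<open>\<epsilon>\<close> of \<open>a\<close>.\<close>

definition tent :: "real \<Rightarrow> real" where
  "tent u = max 0 (1 - \<bar>u\<bar>)"

lemma continuous_tent: "continuous_on UNIV tent"
  unfolding tent_def by (intro continuous_intros)

lemma tent_bounds: "0 \<le> tent u" "tent u \<le> 1"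
  by (auto simp: tent_def)

text \<open>If the claim failed, there would be shifts \<open>s j\<close> violating it for \<open>\<epsilon> = 1 / (j + 1)\<close>. Along a
subsequence the rotated coefficients converge to some \<open>l\<close>, and \<open>l k \<noteq> 0\<close> because rotation preserves
absolute values. So the limiting sum again has countable level sets. Off the level set
\<open>a\<close> of the limit, the shrinking tents tend to 0 pointwise, and dominated convergence contradicts
the assumed lower bound \<open>\<eta>\<close> for the integrals.\<close>

lemma uniformly_thin_level_sets:
  assumes I: "finite I" "\<forall>n\<in>I. \<gamma> n > 0" "inj_on \<gamma> I" "k \<in> I" "z k \<noteq> 0" and "\<eta> > 0"
  shows "\<exists>\<epsilon>>0. \<forall>s. integral {s..s+1} (\<lambda>t. tent ((trig_sum I \<gamma> z t - a) / \<epsilon>)) \<le> \<eta>"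
proof (rule ccontr)
  assume neg: "\<not> ?thesis"
  have "\<exists>s. integral {s..s+1} (\<lambda>t. tent ((trig_sum I \<gamma> z t - a) / (1 / Suc j))) > \<eta>" for j
  proof -
    have "1 / real (Suc j) > 0" by simp
    then show ?thesis using neg by (meson not_le)
  qed
  then obtain s where s: "\<And>j. integral {s j..s j+1}
      (\<lambda>t. tent ((trig_sum I \<gamma> z t - a) / (1 / Suc j))) > \<eta>"
    by metis
  define zs where "zs j n = z n * cis (\<gamma> n * s j)" for j n
  have "\<forall>\<delta>\<subseteq>I. \<exists>l. \<exists>r::nat\<Rightarrow>nat. strict_mono r \<and>
      (\<forall>e>0. \<forall>\<^sub>F j in sequentially. \<forall>n\<in>\<delta>. dist (zs (r j) n) (l n) < e)"
  proof (rule compact_lemma_general[where proj = "\<lambda>x n. x n" and unproj = "\<lambda>x. x"])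
    show "bounded ((\<lambda>x. x n) ` range zs)" for n
      by (auto simp: bounded_iff zs_def norm_mult)
  qed (use I in auto)
  then obtain l and r :: "nat \<Rightarrow> nat" where r: "strict_mono r"
    and lr: "\<And>e. e > 0 \<Longrightarrow> \<forall>\<^sub>F j in sequentially. \<forall>n\<in>I. dist (zs (r j) n) (l n) < e"
    by blast
  have lim: "(\<lambda>j. zs (r j) n) \<longlonglongrightarrow> l n" if "n \<in> I" for n
  proof (rule tendstoI)
    fix e :: real assume "e > 0"
    from lr[OF this] show "\<forall>\<^sub>F j in sequentially. dist (zs (r j) n) (l n) < e"
      by eventually_elim (use that in blast)
  qed
  have "(\<lambda>j. norm (zs (r j) k)) \<longlonglongrightarrow> norm (l k)"
    using lim[OF I(4)] by (rule tendsto_norm)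
  moreover have "norm (zs (r j) k) = norm (z k)" for j by (simp add: zs_def norm_mult)
  ultimately have "norm (l k) = norm (z k)" by (simp add: LIMSEQ_const_iff)
  then have "l k \<noteq> 0" using I by auto
  then have Z: "countable {t. trig_sum I \<gamma> l t = a}" (is "countable ?Z")
    using I by (intro countable_level_set[of I \<gamma> k l])
  define f where "f j t = tent ((trig_sum I \<gamma> (zs (r j)) t - a) / (1 / Suc (r j)))" for j t
  have cont_f: "continuous_on UNIV (f j)" for j
    unfolding f_def
    by (intro continuous_on_compose2[OF continuous_tent] continuous_intros
        trig_poly_continuous_on trig_poly_trig_sum) auto
  have neglig: "negligible ?Z"
    using Z countable_imp_null_set_lborel negligible_iff_null_sets null_sets_completionI by blast
  have drop: "integral ({0..1} - ?Z) (f j) = integral {0..1} (f j)" for j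
    by (rule integral_spike_set) (auto intro: negligible_subset[OF neglig])
  have f_big: "integral {0..1} (f j) > \<eta>" for j
  proof -
    let ?g = "\<lambda>t. tent ((trig_sum I \<gamma> z t - a) / (1 / Suc (r j)))"
    have "integral {0..1} (?g \<circ> ((+) (s (r j)))) = integral {0+s (r j)..1+s (r j)} ?g"
      by (rule integral_shift_Icc_real)
    moreover have "?g \<circ> ((+) (s (r j))) = f j"
      by (simp add: fun_eq_iff f_def trig_sum_shift zs_def[abs_def])
    ultimately show ?thesis using s[of "r j"] by (simp add: add.commute)
  qed
  have "(\<lambda>j. integral ({0..1} - ?Z) (f j)) \<longlonglongrightarrow> integral ({0..1} - ?Z) (\<lambda>t. 0)"
  proof (rule dominated_convergence(2))
    show "f j integrable_on {0..1} - ?Z" for j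
    proof (rule integrable_spike_set)
      show "f j integrable_on {0..1}"
        using cont_f by (meson continuous_on_subset integrable_continuous_interval subset_UNIV)
    qed (auto intro: negligible_subset[OF neglig])
    show "(\<lambda>t. 1::real) integrable_on {0..1} - ?Z"
      by (rule integrable_spike_set[of _ "{0..1}"]) (auto intro: negligible_subset[OF neglig])
    show "norm (f j t) \<le> 1" for j t
      using tent_bounds by (simp add: f_def)
    show "(\<lambda>j. f j t) \<longlonglongrightarrow> 0" if "t \<in> {0..1} - ?Z" for t
    proof -
      define d where "d = trig_sum I \<gamma> l t - a"
      have "d \<noteq> 0" using that by (simp add: d_def)
      have "(\<lambda>j. trig_sum I \<gamma> (zs (r j)) t - a) \<longlonglongrightarrow> d"
        unfolding d_def trig_sum_def wave_def by (intro tendsto_intros lim)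
      then have "(\<lambda>j. \<bar>trig_sum I \<gamma> (zs (r j)) t - a\<bar>) \<longlonglongrightarrow> \<bar>d\<bar>" by (rule tendsto_rabs)
      then have 1: "\<forall>\<^sub>F j in sequentially. \<bar>d\<bar> / 2 < \<bar>trig_sum I \<gamma> (zs (r j)) t - a\<bar>"
        using \<open>d \<noteq> 0\<close> by (intro order_tendstoD) auto
      \<comment> \<open>From this index on, the half width of the tent is below \<open>|d| / 2\<close>.\<close>
      obtain J where J: "real J > 2 / \<bar>d\<bar>" using reals_Archimedean2 by blast
      have "\<forall>\<^sub>F j in sequentially. f j t = 0"
        using 1 eventually_ge_at_top[of J]
      proof eventually_elim
        case (elim j)
        have "real (Suc (r j)) \<ge> real J" using elim seq_suble[OF r, of j] by simp
        then have "real (Suc (r j)) \<ge> 2 / \<bar>d\<bar>" using J by linarith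
        then have "(\<bar>d\<bar> / 2) * (2 / \<bar>d\<bar>) \<le> \<bar>trig_sum I \<gamma> (zs (r j)) t - a\<bar> * real (Suc (r j))"
          using elim by (intro mult_mono) auto
        then have "1 \<le> \<bar>(trig_sum I \<gamma> (zs (r j)) t - a) * real (Suc (r j))\<bar>"
          using \<open>d \<noteq> 0\<close> by (simp add: abs_mult)
        then show ?case by (simp add: f_def tent_def)
      qed
      then show ?thesis by (rule tendsto_eventually)
    qed
  qed
  then have "(\<lambda>j. integral {0..1} (f j)) \<longlonglongrightarrow> 0" by (simp add: drop)
  then have "\<eta> \<le> 0"
    by (rule LIMSEQ_le_const) (use f_big less_imp_le in blast)
  then show False using \<open>\<eta> > 0\<close> by simp
qed

lemma tent_mean_small:
  assumes "finite I" "\<forall>n\<in>I. \<gamma> n > 0" "inj_on \<gamma> I" "k \<in> I" "z k \<noteq> 0" and "\<eta> > 0"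
  shows "\<exists>\<epsilon>>0. \<forall>m. has_mean (\<lambda>t. tent ((trig_sum I \<gamma> z t - a) / \<epsilon>)) m \<longrightarrow> m \<le> \<eta>"
  using uniformly_thin_level_sets[of I \<gamma> k z \<eta> a] assms has_mean_le_of_unit_intervals by blast

section \<open>Logarithmic densities\<close>

text \<open>With an antiderivative \<open>G\<close> of \<open>f\<close>, the function \<open>G \<circ> ln\<close> is an antiderivative of
\<open>f (ln x) / x\<close>. For indicator functions the formula is applied to their continuous bounds.\<close>

lemma log_integral_substitution:
  fixes f :: "real \<Rightarrow> real"
  assumes f: "continuous_on UNIV f" and X: "X \<ge> 1"
  shows "set_integrable lebesgue {1..X} (\<lambda>x. f (ln x) / x)"
    and "(LINT x:{1..X}|lebesgue. f (ln x) / x) = integral {0..ln X} f"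
proof -
  show int: "set_integrable lebesgue {1..X} (\<lambda>x. f (ln x) / x)"
    by (rule absolutely_integrable_continuous_real)
       (intro continuous_intros continuous_on_compose2[OF f], auto)
  define G where "G T = integral {0..T} f" for T
  have "((\<lambda>x. f (ln x) / x) has_integral G (ln X) - G (ln 1)) {1..X}"
  proof (rule fundamental_theorem_of_calculus[OF X])
    fix x assume x: "x \<in> {1..X}"
    have "(G has_real_derivative f (ln x)) (at (ln x) within {0..ln X})"
      unfolding G_def using x
      by (intro integral_has_real_derivative continuous_on_subset[OF f]) auto
    then have "(G has_real_derivative f (ln x)) (at (ln x) within ln ` {1..X})"
      by (rule DERIV_subset) auto
    moreover have "(ln has_real_derivative 1 / x) (at x within {1..X})"
      using x by (auto intro!: derivative_eq_intros)
    ultimately have "((G \<circ> ln) has_real_derivative f (ln x) * (1 / x)) (at x within {1..X})"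
      by (rule DERIV_image_chain)
    then show "((\<lambda>x. G (ln x)) has_vector_derivative f (ln x) / x) (at x within {1..X})"
      by (simp add: has_real_derivative_iff_has_vector_derivative o_def)
  qed
  then have "integral {1..X} (\<lambda>x. f (ln x) / x) = integral {0..ln X} f"
    by (simp add: G_def integral_unique)
  then show "(LINT x:{1..X}|lebesgue. f (ln x) / x) = integral {0..ln X} f"
    using set_lebesgue_integral_eq_integral(2)[OF int] by simp
qed

lemma log_integrable_indicator:
  assumes P: "P \<in> sets lebesgue" and "X \<ge> 1"
  shows "set_integrable lebesgue {1..X} (\<lambda>x. indicat_real P x / x)"
proof -
  have "set_integrable lebesgue {1..X} (\<lambda>x. 1 / x)"
    using log_integral_substitution(1)[of "\<lambda>_. 1"] assms by simp
  then have "set_integrable lebesgue ({1..X} \<inter> P) (\<lambda>x. 1 / x)"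
    by (rule set_integrable_subset) (use P in auto)
  then show ?thesis by (simp add: set_integrable_def indicator_inter_arith)
qed

lemma has_log_density_countable:
  assumes "countable P"
  shows "has_log_density P 0"
proof -
  have null: "P \<in> null_sets lebesgue"
    using assms countable_imp_null_set_lborel null_sets_completionI by blast
  have "(LINT x:{1..X}|lebesgue. indicat_real P x / x) = 0" for X
  proof -
    have "AE x in lebesgue. indicat_real {1..X} x *\<^sub>R (indicat_real P x / x) = 0"
      using AE_not_in[OF null] by eventually_elim simp
    then show ?thesis unfolding set_lebesgue_integral_def by (rule integral_eq_zero_AE)
  qed
  then show ?thesis
    using log_integrable_indicator[of P] null by (auto simp: has_log_density_def)
qed

definition ramp :: "real \<Rightarrow> real" where
  "ramp u = max 0 (min 1 u)"

lemma continuous_ramp: "continuous_on UNIV ramp"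
  unfolding ramp_def by (intro continuous_intros)

lemma ramp_bounds: "0 \<le> ramp u" "ramp u \<le> 1"
  by (auto simp: ramp_def)

text \<open>The two continuous approximations \<open>ramp u\<close> and \<open>ramp (1 + u)\<close> of the indicator of \<open>u > 0\<close>,
one from below and one from above, differ exactly by a tent around the jump.\<close>

lemma ramp_diff: "\<bar>ramp (1 + u) - ramp u\<bar> = tent u"
  by (auto simp: ramp_def tent_def)

text \<open>The indicator of the orthant lies between products of ramps in the coordinates. The products
differ by at most the sum over \<open>d\<close> of the tents around \<open>\<alpha> $ d\<close>; the width \<open>\<epsilon> d\<close> of each tent is
chosen such that its mean is at most \<open>\<eta>\<close> divided by the dimension.\<close>

lemma log_density_orthant_exists:
  fixes h :: "real \<Rightarrow> real ^ 'd" and \<alpha> :: "real ^ 'd"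
  assumes I: "finite I" "\<forall>n\<in>I. \<gamma> n > 0" "inj_on \<gamma> I"
    and h: "\<And>t d. h t $ d = trig_sum I \<gamma> (z d) t"
    and z: "\<And>d. \<exists>k\<in>I. z d k \<noteq> 0"
  shows "\<exists>l. has_log_density {x. x > 0 \<and> (\<forall>d. h (ln x) $ d > \<alpha> $ d)} l"
proof -
  define P where "P = {x. x > 0 \<and> (\<forall>d. h (ln x) $ d > \<alpha> $ d)}"
  have trig: "trig_poly (\<lambda>t. h t $ d)" for d
    using trig_poly_trig_sum[of I \<gamma> "z d"] by (simp add: h)
  \<comment> \<open>The set is open, hence measurable: on the positive reals each coordinate is continuous.\<close>
  have "open ({0<..} \<inter> (\<lambda>x. h (ln x) $ d) -` {\<alpha> $ d<..})" for d
    by (intro continuous_open_preimage continuous_on_compose2[OF trig_poly_continuous_on[OF trig, of UNIV]]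
        continuous_intros) auto
  then have "open ({0<..} \<inter> (\<Inter>d. {0<..} \<inter> (\<lambda>x. h (ln x) $ d) -` {\<alpha> $ d<..}))"
    by (intro open_Int open_INT) auto
  also have "{0<..} \<inter> (\<Inter>d. {0<..} \<inter> (\<lambda>x. h (ln x) $ d) -` {\<alpha> $ d<..}) = P"
    by (auto simp: P_def)
  finally have P: "P \<in> sets lebesgue" by (simp add: borel_open)
  have "\<exists>l. ((\<lambda>X. 1 / ln X * (LINT x:{1..X}|lebesgue. indicat_real P x / x)) \<longlongrightarrow> l) at_top"
  proof (rule tendsto_by_sandwich)
    fix \<eta> :: real assume "\<eta> > 0"
    then have "\<eta> / CARD('d) > 0" by simp
    then have "\<exists>\<epsilon>>0. \<forall>m. has_mean (\<lambda>t. tent ((h t $ d - \<alpha> $ d) / \<epsilon>)) m \<longrightarrow> m \<le> \<eta> / CARD('d)" for d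
      using z[of d] tent_mean_small[of I \<gamma> _ "z d", OF I] unfolding h by blast
    then obtain \<epsilon> where \<epsilon>: "\<And>d. \<epsilon> d > 0"
      and small: "\<And>d m. has_mean (\<lambda>t. tent ((h t $ d - \<alpha> $ d) / \<epsilon> d)) m \<Longrightarrow> m \<le> \<eta> / CARD('d)"
      by metis
    define lo up where "lo y = (\<Prod>d\<in>UNIV. ramp ((y $ d - \<alpha> $ d) / \<epsilon> d))"
      and "up y = (\<Prod>d\<in>UNIV. ramp (1 + (y $ d - \<alpha> $ d) / \<epsilon> d))" for y :: "real ^ 'd"
    have cont: "continuous_on UNIV lo" "continuous_on UNIV up"
      unfolding lo_def up_def
      by (intro continuous_on_prod continuous_on_compose2[OF continuous_ramp] continuous_intros;
          use \<epsilon> in \<open>auto simp: less_imp_neq[symmetric]\<close>)+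
    have "continuous_on UNIV (\<lambda>y::real^'d. tent ((y $ d - \<alpha> $ d) / \<epsilon> d))" for d
      using \<epsilon>[of d] by (intro continuous_on_compose2[OF continuous_tent] continuous_intros) auto
    then have "\<exists>m. has_mean (\<lambda>t. tent ((h t $ d - \<alpha> $ d) / \<epsilon> d)) m" for d
      by (rule continuous_image_has_mean[OF trig])
    then obtain m where m: "\<And>d. has_mean (\<lambda>t. tent ((h t $ d - \<alpha> $ d) / \<epsilon> d)) (m d)"
      by metis
    obtain L U where L: "has_mean (\<lambda>t. lo (h t)) L" and U: "has_mean (\<lambda>t. up (h t)) U"
      using continuous_image_has_mean[OF trig] cont by metis
    have "U \<le> L + (\<Sum>d\<in>UNIV. m d)"
    proof (rule has_mean_mono[OF U has_mean_add[OF L has_mean_sum[OF m]]])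
      fix t
      have "norm (up (h t) - lo (h t))
          \<le> (\<Sum>d\<in>UNIV. norm (ramp (1 + (h t $ d - \<alpha> $ d) / \<epsilon> d) - ramp ((h t $ d - \<alpha> $ d) / \<epsilon> d)))"
        unfolding up_def lo_def by (rule norm_prod_diff) (use ramp_bounds in auto)
      then show "up (h t) \<le> lo (h t) + (\<Sum>d\<in>UNIV. tent ((h t $ d - \<alpha> $ d) / \<epsilon> d))"
        by (simp add: ramp_diff)
    qed
    also have "(\<Sum>d\<in>UNIV. m d) \<le> (\<Sum>d\<in>(UNIV::'d set). \<eta> / CARD('d))"
      by (intro sum_mono small[OF m])
    finally have UL: "U - L \<le> \<eta>" by simp
    have lo_le: "lo (h (ln x)) \<le> indicat_real P x" if "x > 0" for x
    proof (cases "x \<in> P")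
      case True
      then show ?thesis by (simp add: lo_def prod_le_1 ramp_bounds)
    next
      case False
      then obtain d where "h (ln x) $ d \<le> \<alpha> $ d" using \<open>x > 0\<close> by (auto simp: P_def not_less)
      then have "ramp ((h (ln x) $ d - \<alpha> $ d) / \<epsilon> d) = 0"
        using \<epsilon>[of d] divide_nonpos_pos[of "h (ln x) $ d - \<alpha> $ d" "\<epsilon> d"]
        by (simp add: ramp_def)
      then have "lo (h (ln x)) = 0" unfolding lo_def by (intro prod_zero) auto
      then show ?thesis by simp
    qed
    have up_ge: "indicat_real P x \<le> up (h (ln x))" for x
    proof (cases "x \<in> P")
      case True
      have "ramp (1 + (h (ln x) $ d - \<alpha> $ d) / \<epsilon> d) = 1" for d
      proof -
        have "(h (ln x) $ d - \<alpha> $ d) / \<epsilon> d \<ge> 0"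
          using True \<epsilon>[of d] by (auto simp: P_def less_imp_le)
        then show ?thesis by (simp add: ramp_def)
      qed
      then show ?thesis by (simp add: up_def)
    next
      case False
      then show ?thesis by (simp add: up_def prod_nonneg ramp_bounds)
    qed
    have contt: "continuous_on UNIV (\<lambda>t. lo (h t))" "continuous_on UNIV (\<lambda>t. up (h t))"
      using L U has_mean_def by blast+
    show "\<exists>l u L U. (l \<longlongrightarrow> L) at_top \<and> (u \<longlongrightarrow> U) at_top \<and> U - L \<le> \<eta> \<and>
      (\<forall>\<^sub>F X in at_top. l X \<le> 1 / ln X * (LINT x:{1..X}|lebesgue. indicat_real P x / x) \<and>
         1 / ln X * (LINT x:{1..X}|lebesgue. indicat_real P x / x) \<le> u X)"
    proof (intro exI conjI)
      show "((\<lambda>X. integral {0..ln X} (\<lambda>t. lo (h t)) / ln X) \<longlongrightarrow> L) at_top"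
        by (rule filterlim_compose[OF _ ln_at_top, of "\<lambda>T. integral {0..T} (\<lambda>t. lo (h t)) / T"])
           (use L has_mean_def in blast)
      show "((\<lambda>X. integral {0..ln X} (\<lambda>t. up (h t)) / ln X) \<longlongrightarrow> U) at_top"
        by (rule filterlim_compose[OF _ ln_at_top, of "\<lambda>T. integral {0..T} (\<lambda>t. up (h t)) / T"])
           (use U has_mean_def in blast)
      show "\<forall>\<^sub>F X in at_top.
          integral {0..ln X} (\<lambda>t. lo (h t)) / ln X
            \<le> 1 / ln X * (LINT x:{1..X}|lebesgue. indicat_real P x / x) \<and>
          1 / ln X * (LINT x:{1..X}|lebesgue. indicat_real P x / x)
            \<le> integral {0..ln X} (\<lambda>t. up (h t)) / ln X"
        using eventually_gt_at_top[of 1]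
      proof eventually_elim
        case (elim X)
        then have X: "X \<ge> 1" "ln X > 0" by auto
        have "(LINT x:{1..X}|lebesgue. lo (h (ln x)) / x) \<le> (LINT x:{1..X}|lebesgue. indicat_real P x / x)"
          by (intro set_integral_mono log_integral_substitution(1)[OF contt(1)]
              log_integrable_indicator P X) (auto intro!: divide_right_mono lo_le)
        moreover have "(LINT x:{1..X}|lebesgue. indicat_real P x / x) \<le> (LINT x:{1..X}|lebesgue. up (h (ln x)) / x)"
          by (intro set_integral_mono log_integral_substitution(1)[OF contt(2)]
              log_integrable_indicator P X) (auto intro!: divide_right_mono up_ge)
        ultimately show ?case
          using X log_integral_substitution(2)[OF contt(1) X(1)]
            log_integral_substitution(2)[OF contt(2) X(1)]
          by (simp add: divide_right_mono)
      qed
    qed (rule UL)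
  qed
  then show ?thesis
    using log_integrable_indicator[OF P] unfolding has_log_density_def P_def by blast
qed

section \<open>The oscillating vector function\<close>

text \<open>The coefficients of the trigonometric sum \<open>v \<bullet> F\<close>; the sign of the imaginary part is that
of the sine term in \<open>Re (z * cis \<theta>)\<close>.\<close>

definition osc_coeff :: "(nat \<Rightarrow> complex ^ 'd) \<Rightarrow> real ^ 'd \<Rightarrow> nat \<Rightarrow> complex" where
  "osc_coeff c v n = Complex (v \<bullet> cos_vec c n) (- (v \<bullet> sin_vec c n))"

lemma powr_imaginary:
  assumes "x > 0"
  shows "of_real x powr (\<i> * of_real a) = cis (a * ln x)"
    and "of_real x powr (- \<i> * of_real a) = cnj (cis (a * ln x))"
  using assms by (simp_all add: powr_def Ln_of_real cis_conv_exp exp_cnj mult_ac)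

lemma osc_complex_component:
  assumes "x > 0"
  shows "osc_complex N \<gamma> c x $ d = of_real (\<Sum>n=1..N. 2 * Re (cis (\<gamma> n * ln x) * c n $ d))"
proof -
  have "osc_complex N \<gamma> c x $ d
      = (\<Sum>n=1..N. cis (\<gamma> n * ln x) * c n $ d + cnj (cis (\<gamma> n * ln x) * c n $ d))"
    unfolding osc_complex_def powr_imaginary[OF assms] by (simp add: vec_cnj_def)
  also have "\<dots> = of_real (\<Sum>n=1..N. 2 * Re (cis (\<gamma> n * ln x) * c n $ d))"
    unfolding complex_add_cnj by simp
  finally show ?thesis .
qed

lemma osc_eq:
  assumes "x > 0"
  shows "osc N \<gamma> c x =
        (\<Sum>n=1..N. cos (\<gamma> n * ln x) *\<^sub>R cos_vec c n + sin (\<gamma> n * ln x) *\<^sub>R sin_vec c n)"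
  unfolding vec_eq_iff osc_def
  by (simp add: osc_complex_component[OF assms] cos_vec_def sin_vec_def algebra_simps sum_component
      del: of_real_sum)

lemma inner_osc:
  assumes "x > 0"
  shows "v \<bullet> osc N \<gamma> c x = trig_sum {1..N} \<gamma> (osc_coeff c v) (ln x)"
  unfolding osc_eq[OF assms]
  by (simp add: trig_sum_def wave_altdef osc_coeff_def inner_sum_right inner_add_right mult.commute)

text \<open>If all coefficients vanish, then \<open>v\<close> is orthogonal to all generators of the space.\<close>

lemma osc_coeff_nonzero:
  assumes "y \<in> osc_space N c" "v \<bullet> y \<noteq> 0"
  shows "\<exists>k\<in>{1..N}. osc_coeff c v k \<noteq> 0"
proof (rule ccontr)
  assume "\<not> ?thesis"
  then have "cos_vec c ` {1..N} \<union> sin_vec c ` {1..N} \<subseteq> {y. v \<bullet> y = 0}"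
    by (auto simp: osc_coeff_def complex_eq_iff)
  then have "osc_space N c \<subseteq> {y. v \<bullet> y = 0}"
    unfolding osc_space_def by (rule span_minimal) (rule subspace_hyperplane)
  then show False using assms by auto
qed

lemma countable_hyperplane_times:
  assumes "\<forall>n\<in>{1..N}. \<gamma> n > 0" "inj_on \<gamma> {1..N}" "y \<in> osc_space N c" "v \<bullet> y \<noteq> 0"
  shows "countable {x. x > 0 \<and> v \<bullet> osc N \<gamma> c x = a}"
proof -
  obtain k where "k \<in> {1..N}" "osc_coeff c v k \<noteq> 0"
    using osc_coeff_nonzero assms by blast
  then have "countable {t. trig_sum {1..N} \<gamma> (osc_coeff c v) t = a}"
    using assms by (intro countable_level_set) auto
  then have "countable (exp ` {t. trig_sum {1..N} \<gamma> (osc_coeff c v) t = a})" by blast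
  moreover have "{x. x > 0 \<and> v \<bullet> osc N \<gamma> c x = a} \<subseteq> exp ` {t. trig_sum {1..N} \<gamma> (osc_coeff c v) t = a}"
  proof
    fix x assume "x \<in> {x. x > 0 \<and> v \<bullet> osc N \<gamma> c x = a}"
    then have "x > 0" "v \<bullet> osc N \<gamma> c x = a" by auto
    then have "x = exp (ln x)" "trig_sum {1..N} \<gamma> (osc_coeff c v) (ln x) = a"
      using inner_osc[of x v N \<gamma> c] by auto
    then show "x \<in> exp ` {t. trig_sum {1..N} \<gamma> (osc_coeff c v) t = a}" by blast
  qed
  ultimately show ?thesis by (rule countable_subset[rotated])
qed

lemma osc_range_compact:
  "\<exists>K. compact K \<and> K \<subseteq> osc_space N c \<and> osc N \<gamma> c ` {0<..} \<subseteq> K"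
proof -
  define R where "R = (\<Sum>n=1..N. norm (cos_vec c n) + norm (sin_vec c n))"
  have "norm (osc N \<gamma> c x) \<le> R" if "x > 0" for x
    unfolding osc_eq[OF that] R_def
    by (intro sum_norm_le norm_triangle_mono) (auto simp: mult_left_le_one_le)
  moreover have "osc N \<gamma> c x \<in> osc_space N c" if "x > 0" for x
    unfolding osc_eq[OF that] osc_space_def
    by (intro span_sum span_add span_scale span_base) auto
  moreover have "closed (osc_space N c)"
    unfolding osc_space_def by (intro closed_subspace subspace_span)
  then have "compact (osc_space N c \<inter> cball 0 R)" by (simp add: closed_Int_compact)
  ultimately show ?thesis
    by (intro exI[of _ "osc_space N c \<inter> cball 0 R"]) auto
qed

text \<open>The component \<open>v\<close> orthogonal to \<open>H\<close> of a vector \<open>y\<close> outside \<open>H\<close> satisfies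
\<open>v \<bullet> y = v \<bullet> v > 0\<close>, and \<open>v \<bullet> F\<close> is constant on the times when \<open>F\<close> lies in \<open>\<alpha> + H\<close>.\<close>

lemma log_density_affine_subspace:
  assumes "\<forall>n\<in>{1..N}. \<gamma> n > 0" "inj_on \<gamma> {1..N}"
    and H: "subspace H" "\<not> osc_space N c \<subseteq> H"
  shows "has_log_density {x. x > 0 \<and> osc N \<gamma> c x \<in> (+) \<alpha> ` H} 0"
proof -
  obtain y where y: "y \<in> osc_space N c" "y \<notin> H" using H by blast
  obtain p v where pv: "p \<in> span H" "\<And>w. w \<in> span H \<Longrightarrow> orthogonal v w" "y = p + v"
    using orthogonal_subspace_decomp_exists[of H y] by metis
  have "v \<noteq> 0" using pv y H by (metis add.right_neutral span_eq_iff)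
  moreover have "v \<bullet> y = v \<bullet> v"
    using pv by (simp add: inner_add_right orthogonal_def)
  ultimately have "v \<bullet> y \<noteq> 0" by simp
  then have "countable {x. x > 0 \<and> v \<bullet> osc N \<gamma> c x = v \<bullet> \<alpha>}"
    using countable_hyperplane_times assms y by blast
  moreover have "{x. x > 0 \<and> osc N \<gamma> c x \<in> (+) \<alpha> ` H} \<subseteq> {x. x > 0 \<and> v \<bullet> osc N \<gamma> c x = v \<bullet> \<alpha>}"
    using pv(2) by (auto simp: inner_add_right orthogonal_def span_base)
  ultimately show ?thesis using countable_subset has_log_density_countable by blast
qed

theorem theorem1:
  fixes N :: nat and \<gamma> :: "nat \<Rightarrow> real" and c :: "nat \<Rightarrow> complex ^ 'd"
  assumes "N \<ge> 1"
    and "\<forall>n\<in>{1..N}. \<gamma> n > 0"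
    and "inj_on \<gamma> {1..N}"
  shows
    "(\<forall>x>0. (\<chi> d. complex_of_real (osc N \<gamma> c x $ d)) = osc_complex N \<gamma> c x) \<and>
     (\<forall>x>0. osc N \<gamma> c x =
        (\<Sum>n=1..N. cos (\<gamma> n * ln x) *\<^sub>R cos_vec c n + sin (\<gamma> n * ln x) *\<^sub>R sin_vec c n)) \<and>
     (\<exists>K. compact K \<and> K \<subseteq> osc_space N c \<and> osc N \<gamma> c ` {0<..} \<subseteq> K) \<and>
     (\<forall>H \<alpha>. subspace H \<longrightarrow> \<not> osc_space N c \<subseteq> H \<longrightarrow>
        has_log_density {x. x > 0 \<and> osc N \<gamma> c x \<in> (+) \<alpha> ` H} 0) \<and>
     (\<not> osc_space N c \<subseteq> (\<Union>d. {v. v $ d = 0}) \<longrightarrow>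
        (\<forall>\<alpha> :: real ^ 'd.
           (\<forall>d. has_log_density {x. x > 0 \<and> osc N \<gamma> c x $ d = \<alpha> $ d} 0) \<and>
           (\<exists>l. has_log_density {x. x > 0 \<and> (\<forall>d. osc N \<gamma> c x $ d > \<alpha> $ d)} l)))"
proof (intro conjI allI impI)
  show "(\<chi> d. complex_of_real (osc N \<gamma> c x $ d)) = osc_complex N \<gamma> c x" if "x > 0" for x
    unfolding vec_eq_iff osc_def by (simp add: osc_complex_component[OF that] del: of_real_sum)
  show "osc N \<gamma> c x =
        (\<Sum>n=1..N. cos (\<gamma> n * ln x) *\<^sub>R cos_vec c n + sin (\<gamma> n * ln x) *\<^sub>R sin_vec c n)"
    if "x > 0" for x
    using that by (rule osc_eq)
  show "\<exists>K. compact K \<and> K \<subseteq> osc_space N c \<and> osc N \<gamma> c ` {0<..} \<subseteq> K"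
    by (rule osc_range_compact)
  show "has_log_density {x. x > 0 \<and> osc N \<gamma> c x \<in> (+) \<alpha> ` H} 0"
    if "subspace H" "\<not> osc_space N c \<subseteq> H" for H \<alpha>
    using log_density_affine_subspace assms that by blast
  assume "\<not> osc_space N c \<subseteq> (\<Union>d. {v. v $ d = 0})"
  then obtain y where y: "y \<in> osc_space N c" "\<And>d. axis d 1 \<bullet> y \<noteq> 0"
    by (auto simp: inner_axis')
  fix \<alpha> :: "real ^ 'd"
  show "has_log_density {x. x > 0 \<and> osc N \<gamma> c x $ d = \<alpha> $ d} 0" for d
    using countable_hyperplane_times[OF assms(2,3) y, of d "\<alpha> $ d"]
    by (simp add: inner_axis' has_log_density_countable)
  define h where "h t = (\<chi> d. trig_sum {1..N} \<gamma> (osc_coeff c (axis d 1)) t)" for t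
  have "osc N \<gamma> c x = h (ln x)" if "x > 0" for x
    using inner_osc[OF that, of "axis _ 1" N \<gamma> c] by (simp add: vec_eq_iff h_def inner_axis')
  then have "{x. x > 0 \<and> (\<forall>d. osc N \<gamma> c x $ d > \<alpha> $ d)} = {x. x > 0 \<and> (\<forall>d. h (ln x) $ d > \<alpha> $ d)}"
    by auto
  moreover have "\<exists>l. has_log_density {x. x > 0 \<and> (\<forall>d. h (ln x) $ d > \<alpha> $ d)} l"
    using assms osc_coeff_nonzero[OF y]
    by (intro log_density_orthant_exists[where z = "\<lambda>d. osc_coeff c (axis d 1)"]) (auto simp: h_def)
  ultimately show "\<exists>l. has_log_density {x. x > 0 \<and> (\<forall>d. osc N \<gamma> c x $ d > \<alpha> $ d)} l"
    by simp
qed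

end
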